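(* Let $\lVert\cdot\rVert_A$, $\lVert\cdot\rVert_B$, $\lVert\cdot\rVert_C$ and $\lVert\cdot\rVert_D$ be rearrangement-invariant Banach function norms over $([0,\infty),\lambda)$. Then: (1) The embedding $WL(A,C)\hookrightarrow WL(B,C)$ holds if and only if the local component of $\lVert\cdot\rVert_A$ is stronger than that of $\lVert\cdot\rVert_B$, in the sense that for every $f\in M$ the implication $\lVert f^*\chi_{[0,1]}\rVert_A<\infty\Rightarrow\lVert f^*\chi_{[0,1]}\rVert_B<\infty$ holds. (2) The embedding $WL(A,B)\hookrightarrow WL(A,C)$ holds if and only if the global component of $\lVert\cdot\rVert_B$ is stronger than that of $\lVert\cdot\rVert_C$, in the sense that for every $f\in M$ such that $f^*(1)<\infty$ the implication $\lVert f^*\chi_{(1,\infty)}\rVert_B<\infty\Rightarrow\lVert f^*\chi_{(1,\infty)}\rVert_C<\infty$ holds. (3) The embedding $WL(A,B)\hookrightarrow WL(C,D)$ holds if and only if the local component of $\lVert\cdot\rVert_A$ is stronger than that of $\lVert\cdot\rVert_C$ and the global component of $\lVert\cdot\rVert_B$ is stronger than that of $\lVert\cdot\rVert_D$ (in the senses of (1) and (2)).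
   Context: $\lambda$ is Lebesgue measure on $[0,\infty)$; $M$ is the set of extended complex-valued $\lambda$-measurable functions on $[0,\infty)$ (identified when equal a.e.), $M_+$ the non-negative ones. The non-increasing rearrangement of $f\in M$ is $f^*(t)=\inf\{s\ge 0:\lambda(\{|f|>s\})\le t\}$. A Banach function norm is a map $\lVert\cdot\rVert:M\to[0,\infty]$ with $\lVert\,|f|\,\rVert=\lVert f\rVert$ whose restriction to $M_+$ satisfies: (P1) it is positively homogeneous, $\lVert f\rVert=0\Leftrightarrow f=0$ a.e., and $\lVert f+g\rVert\le\lVert f\rVert+\lVert g\rVert$; (P2) $f\le g$ a.e. implies $\lVert f\rVert\le\lVert g\rVert$; (P3) $f_n\uparrow f$ a.e. implies $\lVert f_n\rVert\uparrow\lVert f\rVert$; (P4) $\lVert\chi_E\rVert<\infty$ whenever $\lambda(E)<\infty$; (P5) for every $E$ with $\lambda(E)<\infty$ there is a finite $C_E$ with $\int_E f\,d\lambda\le C_E\lVert f\rVert$ for all $f\in M_+$. It is rearrangement-invariant (r.i.) if $f^*=g^*$ implies $\lVert f\rVert=\lVert g\rVert$. For r.i. Banach function norms $\lVert\cdot\rVert_A,\lVert\cdot\rVert_B$: $\lVert f\rVert_{WL(A,B)}=\lVert f^*\chi_{[0,1]}\rVert_A+\lVert f^*\chi_{(1,\infty)}\rVert_B$ for $f\in M$, and $WL(A,B)=\{f\in M:\lVert f\rVert_{WL(A,B)}<\infty\}$, a space with the quasinorm $\lVert\cdot\rVert_{WL(A,B)}$. $Y\hookrightarrow X$ means $Y\subseteq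 X$ and the identity $Y\to X$ is continuous, i.e. $\lVert f\rVert_X\le K\lVert f\rVert_Y$ for all $f\in Y$ with some finite constant $K$. *)

theory Defs
  imports "HOL-Analysis.Analysis"
begin

section \<open>Extended complex-valued measurable functions on the half-line\<close>

text \<open>
  Functions on the half-line are represented by total functions on the reals; only their
  restrictions to the half-line matter, because everything below refers to them through the
  measure \<open>lam\<close>, whose underlying space is the half-line.
\<close>

abbreviation lam :: "real measure" where
  "lam \<equiv> lebesgue_on {0..}"

text \<open>
  The extended complex numbers: the complex plane with one point at infinity, \<^term>\<open>None\<close>,
  carrying the Borel sets of the one-point compactification.
\<close>

type_synonym ecomplex = "complex option"

definition ecborel :: "ecomplex measure" where
  "ecborel = sigma UNIV {U. openin (Alexandroff_compactification (euclidean :: complex topology)) U}"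

definition ecmod :: "ecomplex \<Rightarrow> ennreal" where
  "ecmod z = (case z of None \<Rightarrow> \<infinity> | Some w \<Rightarrow> ennreal (cmod w))"

definition ec_of_ennreal :: "ennreal \<Rightarrow> ecomplex" where
  "ec_of_ennreal x = (if x = \<infinity> then None else Some (complex_of_real (enn2real x)))"

lemma ecmod_ec_of_ennreal [simp]: "ecmod (ec_of_ennreal x) = x"
  by (cases x) (auto simp: ecmod_def ec_of_ennreal_def)

text \<open>
  Elements of \<open>M\<close> are represented by functions, not by classes modulo almost-everywhere equality.
  Nothing is lost: a Banach function norm takes the same value on almost-everywhere equal
  functions, see \<open>norm_AE_cong\<close> below.
\<close>

definition M :: "(real \<Rightarrow> ecomplex) set" where
  "M = measurable lam ecborel"

text \<open>
  Non-negative functions are given as \<^typ>\<open>ennreal\<close>-valued functions.  \<open>emb\<close> regards such a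
  function as extended complex-valued; \<open>emb_in_M_iff\<close> below shows that the non-negative elements
  of \<open>M\<close> are exactly the images of the functions in \<open>Mplus\<close>.
\<close>

definition Mplus :: "(real \<Rightarrow> ennreal) set" where
  "Mplus = borel_measurable lam"

definition emb :: "(real \<Rightarrow> ennreal) \<Rightarrow> real \<Rightarrow> ecomplex" where
  "emb f = (\<lambda>t. ec_of_ennreal (f t))"

definition fabs :: "(real \<Rightarrow> ecomplex) \<Rightarrow> real \<Rightarrow> ennreal" where
  "fabs f = (\<lambda>t. ecmod (f t))"

lemma fabs_emb [simp]: "fabs (emb f) = f"
  by (simp add: fabs_def emb_def)

lemma space_ecborel [simp]: "space ecborel = UNIV"
  by (simp add: ecborel_def)

lemma open_sets_ecborel:
  "openin (Alexandroff_compactification (euclidean :: complex topology)) U \<Longrightarrow> U \<in> sets ecborel"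
  unfolding ecborel_def by (subst sets_measure_of) auto

lemma ecmod_measurable [measurable]: "ecmod \<in> borel_measurable ecborel"
proof (rule borel_measurableI_greater)
  fix y :: ennreal
  show "{x \<in> space ecborel. y < ecmod x} \<in> sets ecborel"
  proof (cases y)
    case (real r)
    have "{x. y < ecmod x} = insert None (Some ` (topspace euclidean - cball 0 r))"
    proof (intro set_eqI)
      fix x show "x \<in> {x. y < ecmod x} \<longleftrightarrow> x \<in> insert None (Some ` (topspace euclidean - cball 0 r))"
        using real by (cases x) (auto simp: ecmod_def ennreal_less_iff)
    qed
    moreover have "openin (Alexandroff_compactification euclidean)
        (insert None (Some ` (topspace euclidean - cball (0::complex) r)))"
      unfolding openin_Alexandroff_compactification
      by (rule disjI2, rule exI[of _ "cball 0 r"]) (simp add: closed_closedin[symmetric])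
    ultimately show ?thesis by (simp add: open_sets_ecborel)
  next
    case top
    then show ?thesis by simp
  qed
qed

lemma ec_of_ennreal_measurable [measurable]: "ec_of_ennreal \<in> measurable borel ecborel"
  unfolding ecborel_def
proof (rule measurable_measure_of)
  fix U :: "ecomplex set"
  assume "U \<in> {U. openin (Alexandroff_compactification (euclidean :: complex topology)) U}"
  then consider V where "open V" "U = Some ` V"
    | K where "compact K" "U = insert None (Some ` (- K))"
    by (auto simp: openin_Alexandroff_compactification Compl_eq_Diff_UNIV)
  then show "ec_of_ennreal -` U \<inter> space borel \<in> sets borel"
  proof cases
    case 1
    have [measurable]: "V \<in> sets borel" using 1 by auto
    have "ec_of_ennreal -` U = {x. x \<noteq> \<infinity> \<and> complex_of_real (enn2real x) \<in> V}"
      using 1 by (auto simp: ec_of_ennreal_def split: if_splits)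
    also have "\<dots> \<in> sets borel" by measurable
    finally show ?thesis by simp
  next
    case 2
    have [measurable]: "- K \<in> sets borel" using 2 by (auto simp: compact_imp_closed)
    have "ec_of_ennreal -` U = {x. x = \<infinity> \<or> complex_of_real (enn2real x) \<in> - K}"
      using 2 by (auto simp: ec_of_ennreal_def split: if_splits)
    also have "\<dots> \<in> sets borel" by measurable
    finally show ?thesis by simp
  qed
qed auto

lemma fabs_in_Mplus: "f \<in> M \<Longrightarrow> fabs f \<in> Mplus"
  unfolding M_def Mplus_def fabs_def by measurable

lemma emb_in_M_iff: "emb f \<in> M \<longleftrightarrow> f \<in> Mplus"
proof
  show "f \<in> Mplus" if "emb f \<in> M" using fabs_in_Mplus[OF that] by simp
  show "emb f \<in> M" if "f \<in> Mplus" using that unfolding M_def Mplus_def emb_def by measurable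
qed


section \<open>Non-increasing rearrangement\<close>

definition rearr :: "(real \<Rightarrow> ecomplex) \<Rightarrow> real \<Rightarrow> ennreal" where
  "rearr f t = Inf {ennreal s | s. 0 \<le> s \<and> emeasure lam {x \<in> space lam. fabs f x > ennreal s} \<le> ennreal t}"


section \<open>Rearrangement-invariant Banach function norms\<close>

text \<open>A norm is applied to a non-negative function \<open>f\<close> as \<open>N (emb f)\<close>.\<close>

locale banach_function_norm =
  fixes N :: "(real \<Rightarrow> ecomplex) \<Rightarrow> ennreal"
  assumes norm_abs: "h \<in> M \<Longrightarrow> N (emb (fabs h)) = N h"
    and P1_homogeneous:
      "\<lbrakk>f \<in> Mplus; 0 \<le> a\<rbrakk> \<Longrightarrow> N (emb (\<lambda>t. ennreal a * f t)) = ennreal a * N (emb f)"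
    and P1_zero_iff:
      "f \<in> Mplus \<Longrightarrow> N (emb f) = 0 \<longleftrightarrow> (AE t in lam. f t = 0)"
    and P1_triangle:
      "\<lbrakk>f \<in> Mplus; g \<in> Mplus\<rbrakk> \<Longrightarrow> N (emb (\<lambda>t. f t + g t)) \<le> N (emb f) + N (emb g)"
    and P2:
      "\<lbrakk>f \<in> Mplus; g \<in> Mplus; AE t in lam. f t \<le> g t\<rbrakk> \<Longrightarrow> N (emb f) \<le> N (emb g)"
    and P3:
      "\<lbrakk>\<And>n. F n \<in> Mplus; f \<in> Mplus;
        AE t in lam. incseq (\<lambda>n. F n t) \<and> (\<lambda>n. F n t) \<longlonglongrightarrow> f t\<rbrakk>
       \<Longrightarrow> incseq (\<lambda>n. N (emb (F n))) \<and> (\<lambda>n. N (emb (F n))) \<longlonglongrightarrow> N (emb f)"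
    and P4:
      "\<lbrakk>E \<in> sets lam; emeasure lam E < \<infinity>\<rbrakk> \<Longrightarrow> N (emb (indicator E)) < \<infinity>"
    and P5:
      "\<lbrakk>E \<in> sets lam; emeasure lam E < \<infinity>\<rbrakk>
       \<Longrightarrow> \<exists>C\<ge>0. \<forall>f\<in>Mplus. (\<integral>\<^sup>+t\<in>E. f t \<partial>lam) \<le> ennreal C * N (emb f)"

locale ri_banach_function_norm = banach_function_norm +
  assumes rearrangement_invariant:
    "\<lbrakk>h \<in> M; k \<in> M; \<forall>t\<ge>0. rearr h t = rearr k t\<rbrakk> \<Longrightarrow> N h = N k"


lemma (in banach_function_norm) norm_AE_cong:
  assumes "h \<in> M" "k \<in> M" "AE t in lam. h t = k t"
  shows "N h = N k"
proof -
  have "AE t in lam. fabs h t = fabs k t" using assms(3) by eventually_elim (simp add: fabs_def)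
  then have "N (emb (fabs h)) = N (emb (fabs k))"
    by (intro antisym P2 fabs_in_Mplus assms) (auto elim!: eventually_mono)
  then show ?thesis using assms norm_abs by simp
qed


section \<open>Wiener--Luxemburg amalgam spaces\<close>

definition local_part :: "(real \<Rightarrow> ecomplex) \<Rightarrow> real \<Rightarrow> ecomplex" where
  "local_part f = emb (\<lambda>t. rearr f t * indicator {0..1} t)"

definition global_part :: "(real \<Rightarrow> ecomplex) \<Rightarrow> real \<Rightarrow> ecomplex" where
  "global_part f = emb (\<lambda>t. rearr f t * indicator {1<..} t)"

definition WL_norm ::
  "((real \<Rightarrow> ecomplex) \<Rightarrow> ennreal) \<Rightarrow> ((real \<Rightarrow> ecomplex) \<Rightarrow> ennreal) \<Rightarrow> (real \<Rightarrow> ecomplex) \<Rightarrow> ennreal"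
  where "WL_norm A B f = A (local_part f) + B (global_part f)"

definition WL ::
  "((real \<Rightarrow> ecomplex) \<Rightarrow> ennreal) \<Rightarrow> ((real \<Rightarrow> ecomplex) \<Rightarrow> ennreal) \<Rightarrow> (real \<Rightarrow> ecomplex) set"
  where "WL A B = {f \<in> M. WL_norm A B f < \<infinity>}"

definition cont_embedded :: "'f set \<Rightarrow> ('f \<Rightarrow> ennreal) \<Rightarrow> 'f set \<Rightarrow> ('f \<Rightarrow> ennreal) \<Rightarrow> bool" where
  "cont_embedded Y nY X nX \<longleftrightarrow> Y \<subseteq> X \<and> (\<exists>K\<ge>0. \<forall>f\<in>Y. nX f \<le> ennreal K * nY f)"

abbreviation WL_embeds where
  "WL_embeds A B C D \<equiv> cont_embedded (WL A B) (WL_norm A B) (WL C D) (WL_norm C D)"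

definition local_stronger ::
  "((real \<Rightarrow> ecomplex) \<Rightarrow> ennreal) \<Rightarrow> ((real \<Rightarrow> ecomplex) \<Rightarrow> ennreal) \<Rightarrow> bool" where
  "local_stronger A B \<longleftrightarrow> (\<forall>f\<in>M. A (local_part f) < \<infinity> \<longrightarrow> B (local_part f) < \<infinity>)"

definition global_stronger ::
  "((real \<Rightarrow> ecomplex) \<Rightarrow> ennreal) \<Rightarrow> ((real \<Rightarrow> ecomplex) \<Rightarrow> ennreal) \<Rightarrow> bool" where
  "global_stronger A B \<longleftrightarrow>
    (\<forall>f\<in>M. rearr f 1 < \<infinity> \<longrightarrow> A (global_part f) < \<infinity> \<longrightarrow> B (global_part f) < \<infinity>)"

end

theory Submission
  imports Defs
begin

text \<open>
  Only (3) needs an argument: (1) and (2) are the cases in which one component agrees.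
  A non-increasing function on the half-line coincides almost everywhere with its rearrangement.
  Hence truncating \<open>f\<^sup>*\<close> to \<open>[0,1]\<close>, respectively cutting it off at height \<open>f\<^sup>*(1)\<close>, produces elements of
  the amalgam space that test each component separately.  Conversely, (P5) forces
  \<open>f\<^sup>*(1) < \<infinity>\<close> on the source space, so the two component conditions give the inclusion of sets.
  Continuity is then automatic: if it failed, a weighted sum of the rearrangements of
  counterexamples, being non-increasing, would lie in the source space but not in the target.
\<close>

section \<open>Non-increasing functions and their rearrangements\<close>

text \<open>Superlevel sets of a non-increasing function on the half-line are intervals, hence
  Borel.\<close>

lemma antimono_on_in_Mplus:
  assumes "antimono_on {0..} g"
  shows "g \<in> Mplus"
  unfolding Mplus_def
proof (rule borel_measurableI_greater)
  fix y :: ennreal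
  have "is_interval {x \<in> {0..}. y < g x}"
    unfolding is_interval_1
    using assms by (auto simp: monotone_on_def intro: less_le_trans)
  then have "{x \<in> {0..}. y < g x} \<in> sets borel"
    by (rule real_interval_borel_measurable)
  then show "{x \<in> space lam. y < g x} \<in> sets lam"
    by (auto simp: sets_restrict_space_iff)
qed

lemma mult_indicator_in_Mplus:
  assumes "f \<in> Mplus" "S \<in> sets borel"
  shows "(\<lambda>t. f t * indicator S t) \<in> Mplus"
proof -
  have "indicator S \<in> borel_measurable lam"
    using assms(2) by (intro measurable_restrict_space1 borel_measurable_indicator) simp
  then show ?thesis
    using assms(1) unfolding Mplus_def by (intro borel_measurable_times_ennreal)
qed

lemma antimono_rearr: "antimono (rearr f)"
proof (intro antimonoI)
  fix t u :: real
  assume "t \<le> u"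
  then have "ennreal t \<le> ennreal u"
    by (rule ennreal_leI)
  then show "rearr f u \<le> rearr f t"
    unfolding rearr_def by (intro Inf_superset_mono) (use order_trans in blast)
qed

lemma rearr_in_Mplus: "rearr f \<in> Mplus"
  using antimono_rearr by (intro antimono_on_in_Mplus) (auto simp: monotone_on_def)

text \<open>A finite height \<open>g t\<close> is itself admissible in the infimum, since by
  monotonicity \<open>g\<close> exceeds it only within \<open>{0..<t}\<close>.\<close>

lemma rearr_emb_le:
  assumes "antimono_on {0..} g" "0 \<le> t"
  shows "rearr (emb g) t \<le> g t"
proof (cases "g t")
  case (real r)
  have "{x \<in> space lam. g x > g t} \<subseteq> {0..<t}"
    using assms by (auto simp: monotone_on_def not_le[symmetric])
  then have "emeasure lam {x \<in> space lam. g x > g t} \<le> emeasure lam {0..<t}"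
    by (intro emeasure_mono) (auto simp: sets_restrict_space_iff)
  also have "\<dots> = ennreal t"
    using assms by (simp add: emeasure_restrict_space subset_iff)
  finally show ?thesis
    unfolding rearr_def using real by (intro Inf_lower) auto
qed simp

text \<open>A height \<open>s\<close> below \<open>g u\<close> is exceeded on all of
  \<open>{0..u}\<close>, a set of measure \<open>u > t\<close>, so it is not admissible. Strictness
  of \<open>t < u\<close> matters: for the indicator of \<open>{0..1}\<close> the rearrangement
  already vanishes at 1.\<close>

lemma le_rearr_emb:
  assumes "antimono_on {0..} g" "0 \<le> t" "t < u"
  shows "g u \<le> rearr (emb g) t"
  unfolding rearr_def
proof (rule Inf_greatest, clarsimp)
  fix s :: real
  assume s: "0 \<le> s" and le: "emeasure lam {x. 0 \<le> x \<and> ennreal s < g x} \<le> ennreal t"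
  have [measurable]: "g \<in> borel_measurable lam"
    using antimono_on_in_Mplus[OF assms(1)] by (simp add: Mplus_def)
  have meas: "{x \<in> space lam. ennreal s < g x} \<in> sets lam"
    by measurable
  show "g u \<le> ennreal s"
  proof (rule ccontr)
    assume "\<not> g u \<le> ennreal s"
    moreover have "g u \<le> g x" if "0 \<le> x" "x \<le> u" for x
      using assms that by (auto simp: monotone_on_def)
    ultimately have "{0..u} \<subseteq> {x. 0 \<le> x \<and> ennreal s < g x}"
      by (auto simp: not_le intro: less_le_trans)
    moreover have "{x. 0 \<le> x \<and> ennreal s < g x} \<in> sets lam"
      using meas by simp
    ultimately have "emeasure lam {0..u} \<le> emeasure lam {x. 0 \<le> x \<and> ennreal s < g x}"
      by (rule emeasure_mono)
    also note le
    also have "emeasure lam {0..u} = ennreal u"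
      using assms by (simp add: emeasure_restrict_space subset_iff)
    finally have "ennreal u \<le> ennreal t" .
    then show False
      using assms by simp
  qed
qed

text \<open>The two preceding bounds squeeze the rearrangement between \<open>g t\<close> and the
  values of \<open>g\<close> to the right of \<open>t\<close>, so the functions differ only at jumps
  of \<open>g\<close>, and there are countably many of these.\<close>

lemma AE_rearr_emb_eq:
  assumes "antimono_on {0..} g"
  shows "AE t in lam. rearr (emb g) t = g t"
proof -
  define jump where "jump = {t. 0 \<le> t \<and> rearr (emb g) t \<noteq> g t}"
  \<comment> \<open>The jumps are sorted by the rationals lying strictly inside the gap.\<close>
  define J where "J q = {t. 0 \<le> t \<and> rearr (emb g) t < ennreal (real_of_rat q) \<and> ennreal (real_of_rat q) < g t}" for q
  have "countable (J q)" for q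
  proof (intro countable_finite finite_subset[of "J q" "{SOME t. t \<in> J q}"])
    \<comment> \<open>Gaps at different points are disjoint: if \<open>t < u\<close> both belonged
      to \<open>J q\<close>, then q would be below \<open>g u\<close>, which is at most the
      rearrangement at \<open>t\<close>, which is below q.\<close>
    have "t = u" if "t \<in> J q" "u \<in> J q" for t u
    proof (rule ccontr)
      assume "t \<noteq> u"
      then show False
        using that le_rearr_emb[OF assms, of t u] le_rearr_emb[OF assms, of u t]
        unfolding J_def by (auto simp: neq_iff dest: less_le_trans)
    qed
    then show "J q \<subseteq> {SOME t. t \<in> J q}"
      by (metis insertCI someI subsetI)
  qed simp
  moreover have "jump \<subseteq> (\<Union>q. J q)"
  proof
    fix t assume t: "t \<in> jump"
    then have "rearr (emb g) t < g t"
      using rearr_emb_le[OF assms, of t] by (auto simp: jump_def)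
    then obtain q where "rearr (emb g) t < ennreal (real_of_rat q)" "ennreal (real_of_rat q) < g t"
      using ennreal_rat_dense by blast
    then show "t \<in> (\<Union>q. J q)"
      using t by (auto simp: J_def jump_def)
  qed
  ultimately have "countable jump"
    by (meson countable_UN countable_subset countableI_type)
  then have "AE t in lebesgue. t \<notin> jump"
    by (intro AE_not_in) (simp add: countable_imp_null_set_lborel null_sets_completionI)
  then show ?thesis
    by (auto simp: AE_restrict_space_iff jump_def elim!: eventually_mono)
qed

section \<open>Function norms of non-negative functions\<close>

context banach_function_norm
begin

lemma norm_zero: "N (emb (\<lambda>t. 0)) = 0"
  by (subst P1_zero_iff) (auto simp: Mplus_def)

lemma norm_sum_le:
  assumes "\<And>n. F n \<in> Mplus"
  shows "N (emb (\<lambda>t. \<Sum>i<(n::nat). F i t)) \<le> (\<Sum>i<n. N (emb (F i)))"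
proof (induction n)
  case 0
  then show ?case by (simp add: norm_zero)
next
  case (Suc n)
  have "(\<lambda>t. \<Sum>i<n. F i t) \<in> Mplus"
    using assms by (simp add: Mplus_def)
  then have "N (emb (\<lambda>t. \<Sum>i<Suc n. F i t)) \<le> N (emb (\<lambda>t. \<Sum>i<n. F i t)) + N (emb (F n))"
    using P1_triangle assms by simp
  also have "\<dots> \<le> (\<Sum>i<Suc n. N (emb (F i)))"
    using Suc by (simp add: add_right_mono)
  finally show ?case .
qed

text \<open>Countable subadditivity: (P3) passes the triangle inequality for partial sums to the
  limit.\<close>

lemma norm_suminf_le:
  fixes F :: "nat \<Rightarrow> real \<Rightarrow> ennreal"
  assumes "\<And>n. F n \<in> Mplus"
  shows "N (emb (\<lambda>t. \<Sum>n. F n t)) \<le> (\<Sum>n. N (emb (F n)))"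
proof -
  have "(\<lambda>n. N (emb (\<lambda>t. \<Sum>i<n. F i t))) \<longlonglongrightarrow> N (emb (\<lambda>t. \<Sum>n. F n t))"
  proof (rule P3[THEN conjunct2])
    show "AE t in lam. incseq (\<lambda>n. \<Sum>i<n. F i t) \<and> (\<lambda>n. \<Sum>i<n. F i t) \<longlonglongrightarrow> (\<Sum>n. F n t)"
      by (auto simp: incseq_def intro!: summable_LIMSEQ sum_mono2)
  qed (use assms in \<open>simp_all add: Mplus_def\<close>)
  moreover have "N (emb (\<lambda>t. \<Sum>i<n. F i t)) \<le> (\<Sum>n. N (emb (F n)))" for n
    using norm_sum_le[of F n, OF assms] by (rule order_trans) (simp add: sum_le_suminf)
  ultimately show ?thesis
    by (intro LIMSEQ_le_const2) auto
qed

text \<open>For non-increasing test functions this and its global counterpart remove the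
  rearrangement from the norms, since changes on null sets are invisible to
  \<open>N\<close>.\<close>

lemma norm_local_part_emb:
  assumes "antimono_on {0..} g"
  shows "N (local_part (emb g)) = N (emb (\<lambda>t. g t * indicator {0..1} t))"
  unfolding local_part_def
proof (rule norm_AE_cong)
  show "AE t in lam. emb (\<lambda>t. rearr (emb g) t * indicator {0..1} t) t
      = emb (\<lambda>t. g t * indicator {0..1} t) t"
    using AE_rearr_emb_eq[OF assms] by eventually_elim (simp add: emb_def)
qed (simp_all add: emb_in_M_iff mult_indicator_in_Mplus rearr_in_Mplus antimono_on_in_Mplus[OF assms])

lemma norm_global_part_emb:
  assumes "antimono_on {0..} g"
  shows "N (global_part (emb g)) = N (emb (\<lambda>t. g t * indicator {1<..} t))"
  unfolding global_part_def
proof (rule norm_AE_cong)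
  show "AE t in lam. emb (\<lambda>t. rearr (emb g) t * indicator {1<..} t) t
      = emb (\<lambda>t. g t * indicator {1<..} t) t"
    using AE_rearr_emb_eq[OF assms] by eventually_elim (simp add: emb_def)
qed (simp_all add: emb_in_M_iff mult_indicator_in_Mplus rearr_in_Mplus antimono_on_in_Mplus[OF assms])

text \<open>On \<open>{0..1}\<close> the rearrangement is at least its value at 1, so this value is
  at most its integral there, which (P5) bounds by the norm. This supplies the side condition in
  \<open>global_stronger\<close>.\<close>

lemma rearr_1_finite:
  assumes "N (local_part f) < \<infinity>"
  shows "rearr f 1 < \<infinity>"
proof -
  have I: "{0..1} \<in> sets lam" "emeasure lam {0..1::real} = 1"
    by (auto simp: sets_restrict_space_iff emeasure_restrict_space subset_iff)
  have m: "(\<lambda>t. rearr f t * indicator {0..1} t) \<in> Mplus"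
    by (simp add: mult_indicator_in_Mplus rearr_in_Mplus)
  obtain c where c: "\<And>g. g \<in> Mplus \<Longrightarrow> (\<integral>\<^sup>+t\<in>{0..1}. g t \<partial>lam) \<le> ennreal c * N (emb g)"
    using P5[of "{0..1}"] I by auto
  have "rearr f 1 = (\<integral>\<^sup>+t\<in>{0..1}. rearr f 1 \<partial>lam)"
    using I by (simp add: nn_integral_cmult_indicator)
  also have "\<dots> \<le> (\<integral>\<^sup>+t\<in>{0..1}. (rearr f t * indicator {0..1} t) \<partial>lam)"
    using antimono_rearr[of f]
    by (intro nn_integral_mono) (auto simp: antimono_def split: split_indicator)
  also have "\<dots> \<le> ennreal c * N (local_part f)"
    using c[OF m] by (simp add: local_part_def)
  also have "\<dots> < \<infinity>"
    using assms by (simp add: ennreal_mult_less_top)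
  finally show ?thesis .
qed

end

section \<open>Embeddings of Wiener--Luxemburg amalgams\<close>

text \<open>Summing the rearrangements instead of the counterexamples themselves keeps the sum
  non-increasing. Its two components then split termwise, and the argument uses only properties of
  the norms, not of the quasinorm \<open>WL_norm\<close>.\<close>

lemma WL_subset_imp_embeds:
  assumes "banach_function_norm A" "banach_function_norm B"
    and "banach_function_norm C" "banach_function_norm D"
    and sub: "WL A B \<subseteq> WL C D"
  shows "WL_embeds A B C D"
proof (rule ccontr)
  interpret A: banach_function_norm A by fact
  interpret B: banach_function_norm B by fact
  interpret C: banach_function_norm C by fact
  interpret D: banach_function_norm D by fact
  assume "\<not> WL_embeds A B C D"
  then have "\<exists>f\<in>WL A B. ennreal K * WL_norm A B f < WL_norm C D f" if "0 \<le> K" for K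
    using sub that unfolding cont_embedded_def by (meson not_le)
  \<comment> \<open>The ratio 4^n beats the weight 2^-n used below and leaves a factor 2^n, which is
    unbounded.\<close>
  then have "\<forall>n::nat. \<exists>f\<in>WL A B. ennreal (4 ^ n) * WL_norm A B f < WL_norm C D f"
    by simp
  then obtain f where f: "\<And>n. f n \<in> WL A B"
    and large: "\<And>n. ennreal (4 ^ n) * WL_norm A B (f n) < WL_norm C D (f n)"
    by metis
  define \<alpha> where "\<alpha> n = enn2real (WL_norm A B (f n))" for n
  have \<alpha>: "WL_norm A B (f n) = ennreal (\<alpha> n)" for n
    using f[of n] by (simp add: \<alpha>_def WL_def)
  have local_M: "(\<lambda>t. rearr h t * indicator {0..1} t) \<in> Mplus"
    and global_M: "(\<lambda>t. rearr h t * indicator {1<..} t) \<in> Mplus" for h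
    by (simp_all add: mult_indicator_in_Mplus rearr_in_Mplus)
  \<comment> \<open>Needed in order to divide by \<alpha>. If the source norm vanished, both
    components of the rearrangement would be zero almost everywhere, and so the target norm would
    vanish too.\<close>
  have pos: "\<alpha> n > 0" for n
  proof (rule ccontr)
    assume "\<not> \<alpha> n > 0"
    then have "WL_norm A B (f n) = 0"
      by (simp add: \<alpha> ennreal_eq_0_iff)
    then have "WL_norm C D (f n) = 0"
      using local_M global_M
      by (simp add: WL_norm_def local_part_def global_part_def A.P1_zero_iff B.P1_zero_iff
          C.P1_zero_iff D.P1_zero_iff)
    then show False
      using large[of n] by simp
  qed
  \<comment> \<open>Each term is normalised to source norm 2^-n.\<close>
  define c where "c n = 1 / (2 ^ n * \<alpha> n)" for n
  have c_pos: "c n > 0" for n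
    using pos by (simp add: c_def)
  define g where "g t = (\<Sum>n. ennreal (c n) * rearr (f n) t)" for t
  have g_anti: "antimono_on {0..} g"
    unfolding g_def using antimono_rearr
    by (auto simp: monotone_on_def antimono_def intro!: suminf_le mult_left_mono)
  have g_local: "g t * indicator {0..1} t
      = (\<Sum>n. ennreal (c n) * (rearr (f n) t * indicator {0..1} t))"
    and g_global: "g t * indicator {1<..} t
      = (\<Sum>n. ennreal (c n) * (rearr (f n) t * indicator {1<..} t))" for t
    by (auto simp: g_def split: split_indicator)
  \<comment> \<open>Applied below with \<open>u n\<close> the local or the global summand of the
    source norm.\<close>
  have summable: "(\<Sum>n. ennreal (c n) * u n) < \<infinity>" if "\<And>n. u n \<le> WL_norm A B (f n)" for u
  proof -
    have "ennreal (c n) * u n \<le> ennreal ((1 / 2) ^ n)" for n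
    proof -
      have "ennreal (c n) * u n \<le> ennreal (c n) * ennreal (\<alpha> n)"
        using that[of n] by (simp add: \<alpha> mult_left_mono)
      also have "\<dots> = ennreal ((1 / 2) ^ n)"
        using pos[of n] by (simp add: c_def power_one_over flip: ennreal_mult)
      finally show ?thesis .
    qed
    then have "(\<Sum>n. ennreal (c n) * u n) \<le> (\<Sum>n. ennreal ((1 / 2) ^ n))"
      by (intro suminf_le) auto
    also have "\<dots> < \<infinity>"
      by (subst suminf_ennreal2) auto
    finally show ?thesis .
  qed
  have "A (local_part (emb g)) \<le> (\<Sum>n. ennreal (c n) * A (local_part (f n)))"
    unfolding A.norm_local_part_emb[OF g_anti] g_local
      unfolding local_part_def
    using local_M c_pos
    by (subst A.P1_homogeneous[symmetric], (simp_all add: less_imp_le)[2])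
      (intro A.norm_suminf_le, simp add: Mplus_def)
  also have "\<dots> < \<infinity>"
    by (intro summable) (simp add: WL_norm_def)
  finally have A_fin: "A (local_part (emb g)) < \<infinity>" .
  have "B (global_part (emb g)) \<le> (\<Sum>n. ennreal (c n) * B (global_part (f n)))"
    unfolding B.norm_global_part_emb[OF g_anti] g_global
      unfolding global_part_def
    using global_M c_pos
    by (subst B.P1_homogeneous[symmetric], (simp_all add: less_imp_le)[2])
      (intro B.norm_suminf_le, simp add: Mplus_def)
  also have "\<dots> < \<infinity>"
    by (intro summable) (simp add: WL_norm_def)
  finally have "emb g \<in> WL A B"
    using A_fin antimono_on_in_Mplus[OF g_anti] by (simp add: WL_def WL_norm_def emb_in_M_iff)
  then have "WL_norm C D (emb g) < \<infinity>"
    using sub by (auto simp: WL_def)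
  then obtain r where r: "WL_norm C D (emb g) = ennreal r" "0 \<le> r"
    by (cases "WL_norm C D (emb g)") auto
  obtain n where n: "r < 2 ^ n"
    using real_arch_pow[of 2 r] by auto
  \<comment> \<open>A single term of the series is a pointwise lower bound for \<open>g\<close>;
    (P2) turns this into a lower bound for its target norm.\<close>
  have term_le: "ennreal (c n) * v n \<le> (\<Sum>n. ennreal (c n) * v n)" for v
    using sum_le_suminf[of "\<lambda>n. ennreal (c n) * v n" "{n}"] by simp
  have "ennreal (2 ^ n) = ennreal (c n) * (ennreal (4 ^ n) * WL_norm A B (f n))"
    using pos[of n] by (simp add: \<alpha> c_def field_simps flip: ennreal_mult power_mult_distrib)
  also have "\<dots> \<le> ennreal (c n) * WL_norm C D (f n)"
    using large[of n] by (intro mult_left_mono) auto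
  also have "\<dots> = ennreal (c n) * C (local_part (f n)) + ennreal (c n) * D (global_part (f n))"
    by (simp add: WL_norm_def distrib_left)
  also have "\<dots> \<le> C (local_part (emb g)) + D (global_part (emb g))"
  proof (intro add_mono)
    show "ennreal (c n) * C (local_part (f n)) \<le> C (local_part (emb g))"
      unfolding C.norm_local_part_emb[OF g_anti] g_local
      unfolding local_part_def
      using local_M c_pos
      by (subst C.P1_homogeneous[symmetric], (simp_all add: less_imp_le)[2])
        (intro C.P2, auto simp: Mplus_def intro!: term_le)
    show "ennreal (c n) * D (global_part (f n)) \<le> D (global_part (emb g))"
      unfolding D.norm_global_part_emb[OF g_anti] g_global
      unfolding global_part_def
      using global_M c_pos
      by (subst D.P1_homogeneous[symmetric], (simp_all add: less_imp_le)[2])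
        (intro D.P2, auto simp: Mplus_def intro!: term_le)
  qed
  also have "\<dots> = ennreal r"
    using r by (simp add: WL_norm_def)
  finally show False
    using n r by simp
qed

lemma stronger_imp_WL_subset:
  assumes "banach_function_norm A" "local_stronger A C" "global_stronger B D"
  shows "WL A B \<subseteq> WL C D"
  using assms banach_function_norm.rearr_1_finite[OF assms(1)]
  by (auto simp: WL_def WL_norm_def local_stronger_def global_stronger_def)

text \<open>The test function is \<open>rearr f\<close> cut off after 1: its local component has the
  same norm as that of \<open>f\<close>, and its global component has norm zero.\<close>

lemma WL_subset_imp_local_stronger:
  assumes "banach_function_norm A" "banach_function_norm B" "banach_function_norm C"
    and sub: "WL A B \<subseteq> WL C D"
  shows "local_stronger A C"
  unfolding local_stronger_def
proof (intro ballI impI)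
  interpret A: banach_function_norm A by fact
  interpret B: banach_function_norm B by fact
  interpret C: banach_function_norm C by fact
  fix f assume fin: "A (local_part f) < \<infinity>"
  define g where "g t = rearr f t * indicator {0..1} t" for t
  have g_anti: "antimono_on {0..} g"
    using antimono_rearr[of f]
    by (auto simp: g_def monotone_on_def antimono_def split: split_indicator)
  have loc: "emb (\<lambda>t. g t * indicator {0..1} t) = local_part f"
    by (auto simp: g_def local_part_def mult.assoc indicator_inter_arith[symmetric])
  have glob: "(\<lambda>t. g t * indicator {1<..} t) = (\<lambda>t. 0)"
    by (auto simp: g_def split: split_indicator)
  have "emb g \<in> WL A B"
    using fin antimono_on_in_Mplus[OF g_anti]
    by (simp add: WL_def WL_norm_def emb_in_M_iff A.norm_local_part_emb[OF g_anti]
        B.norm_global_part_emb[OF g_anti] loc glob B.norm_zero)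
  then have "C (local_part (emb g)) < \<infinity>"
    using sub by (auto simp: WL_def WL_norm_def)
  then show "C (local_part f) < \<infinity>"
    by (simp add: C.norm_local_part_emb[OF g_anti] loc)
qed

lemma WL_subset_imp_global_stronger:
  assumes "banach_function_norm A" "banach_function_norm B" "banach_function_norm D"
    and sub: "WL A B \<subseteq> WL C D"
  shows "global_stronger B D"
  unfolding global_stronger_def
proof (intro ballI impI)
  interpret A: banach_function_norm A by fact
  interpret B: banach_function_norm B by fact
  interpret D: banach_function_norm D by fact
  fix f assume f1: "rearr f 1 < \<infinity>" and fin: "B (global_part f) < \<infinity>"
  \<comment> \<open>Capping at the value at 1 keeps the function non-increasing and unchanged beyond
    1, while on \<open>{0..1}\<close> it becomes constant. That constant is finite by
    \<open>f1\<close>, so (P4) makes the local norm finite.\<close>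
  define g where "g t = min (rearr f 1) (rearr f t)" for t
  have anti: "rearr f u \<le> rearr f t" if "t \<le> u" for t u
    using antimono_rearr[of f] that by (simp add: antimono_def)
  have g_anti: "antimono_on {0..} g"
    unfolding g_def monotone_on_def by (intro ballI impI min.mono anti order_refl)
  obtain b where b: "rearr f 1 = ennreal b" "0 \<le> b"
    using f1 by (cases "rearr f 1") auto
  have loc: "(\<lambda>t. g t * indicator {0..1} t) = (\<lambda>t. ennreal b * indicator {0..1} t)"
    using anti by (auto simp: g_def b(1)[symmetric] min_absorb1 split: split_indicator)
  have glob: "emb (\<lambda>t. g t * indicator {1<..} t) = global_part f"
    unfolding global_part_def
    using anti by (intro arg_cong[where f = emb]) (auto simp: g_def min_absorb2 split: split_indicator)
  have I: "{0..1} \<in> sets lam" "emeasure lam {0..1::real} < \<infinity>"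
    by (auto simp: sets_restrict_space_iff emeasure_restrict_space subset_iff)
  then have "A (emb (\<lambda>t. ennreal b * indicator {0..1} t)) < \<infinity>"
    using A.P4[OF I] b by (subst A.P1_homogeneous) (auto simp: Mplus_def ennreal_mult_less_top)
  then have "emb g \<in> WL A B"
    using fin antimono_on_in_Mplus[OF g_anti]
    by (simp add: WL_def WL_norm_def emb_in_M_iff A.norm_local_part_emb[OF g_anti]
        B.norm_global_part_emb[OF g_anti] loc glob)
  then have "D (global_part (emb g)) < \<infinity>"
    using sub by (auto simp: WL_def WL_norm_def)
  then show "D (global_part f) < \<infinity>"
    by (simp add: D.norm_global_part_emb[OF g_anti] glob)
qed

lemma WL_embeds_iff:
  assumes "banach_function_norm A" "banach_function_norm B"
    and "banach_function_norm C" "banach_function_norm D"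
  shows "WL_embeds A B C D \<longleftrightarrow> local_stronger A C \<and> global_stronger B D"
proof
  assume "WL_embeds A B C D"
  then have "WL A B \<subseteq> WL C D"
    by (simp add: cont_embedded_def)
  then show "local_stronger A C \<and> global_stronger B D"
    using assms WL_subset_imp_local_stronger WL_subset_imp_global_stronger by blast
next
  assume "local_stronger A C \<and> global_stronger B D"
  then show "WL_embeds A B C D"
    using assms by (intro WL_subset_imp_embeds stronger_imp_WL_subset) auto
qed

theorem theorem3p7:
  fixes A B C D :: "(real \<Rightarrow> ecomplex) \<Rightarrow> ennreal"
  assumes "ri_banach_function_norm A"
    and "ri_banach_function_norm B"
    and "ri_banach_function_norm C"
    and "ri_banach_function_norm D"
  shows "(WL_embeds A C B C \<longleftrightarrow> local_stronger A B)
    \<and> (WL_embeds A B A C \<longleftrightarrow> global_stronger B C)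
    \<and> (WL_embeds A B C D \<longleftrightarrow> local_stronger A C \<and> global_stronger B D)"
proof -
  have "banach_function_norm A" "banach_function_norm B" "banach_function_norm C" "banach_function_norm D"
    using assms by (simp_all add: ri_banach_function_norm_def)
  \<comment> \<open>The component shared by both spaces imposes no condition.\<close>
  moreover have "local_stronger A A" "global_stronger C C"
    by (simp_all add: local_stronger_def global_stronger_def)
  ultimately show ?thesis
    by (simp add: WL_embeds_iff)
qed

end
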